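(* Let $T$ be a set, $d$ a pseudometric on $T$, $R\colon T\to\mathbf{N}$ a function, and $p\geq 1$ a real number. Then, for all $X$ and $Y$ in $T$: 1. $d(X,Y)\geq d_{\bowtie}\left(\widehat{R}_d(X),\widehat{R}_d(Y)\right)$. 2. $c\, d(X,Y)^{\frac{1}{p}}\geq L_p\left(\widehat{R}_d(X),\widehat{R}_d(Y)\right)$, where $c=\max\{\widehat{R}_d(X)(0),\widehat{R}_d(Y)(0)\}$.
   Context: $\mathbf{N}=\{0,1,\ldots\}$. A pseudometric on $T$ is a function $d\colon T\times T\to[0,\infty]$ (the value $\infty$ is allowed) with $d(X,X)=0$, $d(X,Y)=d(Y,X)$ and $d(X,Y)+d(Y,Z)\geq d(X,Z)$ for all $X,Y,Z$ in $T$. For $X$ in $T$, the function $\widehat{R}_d(X)\colon[0,\infty)\to[0,\infty)$ is defined by $\widehat{R}_d(X)(t):=\min\{R(Y)\mid Y\in T,\ d(X,Y)\leq t\}$. It is non-increasing, hence Lebesgue measurable. For Lebesgue measurable functions $f,g\colon[0,\infty)\to[0,\infty)$: $L_p(f,g):=\left(\int_0^\infty|f(t)-g(t)|^p\,dt\right)^{1/p}\in[0,\infty]$, and $d_{\bowtie}(f,g):=\inf S$ if $S\neq\emptyset$, $d_{\bowtie}(f,g):=\infty$ otherwise, where $S:=\{\epsilon\in[0,\infty)\mid f(t)\geq g(t+\epsilon)\text{ and }g(t)\geq f(t+\epsilon)\text{ for all }t\in[0,\infty)\}$. *)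

theory Defs
  imports "HOL-Analysis.Analysis"
begin

definition pseudometric_on :: "'a set \<Rightarrow> ('a \<Rightarrow> 'a \<Rightarrow> ennreal) \<Rightarrow> bool" where
  "pseudometric_on T d \<longleftrightarrow>
     (\<forall>X\<in>T. d X X = 0) \<and>
     (\<forall>X\<in>T. \<forall>Y\<in>T. d X Y = d Y X) \<and>
     (\<forall>X\<in>T. \<forall>Y\<in>T. \<forall>Z\<in>T. d X Z \<le> d X Y + d Y Z)"

(* Functions on [0,\<infinity>) are represented by functions on the reals; only their values at t \<ge> 0
   are meaningful.  The set of values may be infinite, so the minimum is taken with LEAST
   and not with the operator Min for finite sets; it is attained because d X X = 0. *)
definition stabilization ::
    "'a set \<Rightarrow> ('a \<Rightarrow> 'a \<Rightarrow> ennreal) \<Rightarrow> ('a \<Rightarrow> nat) \<Rightarrow> 'a \<Rightarrow> real \<Rightarrow> real" where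
  "stabilization T d R X t = real (LEAST n. n \<in> {R Y | Y. Y \<in> T \<and> d X Y \<le> ennreal t})"

(* Real powers on [0,\<infinity>], for exponents a > 0. *)
definition ennreal_powr :: "ennreal \<Rightarrow> real \<Rightarrow> ennreal" where
  "ennreal_powr x a = (if x = \<infinity> then \<infinity> else ennreal (enn2real x powr a))"

definition Lp_distance :: "real \<Rightarrow> (real \<Rightarrow> real) \<Rightarrow> (real \<Rightarrow> real) \<Rightarrow> ennreal" where
  "Lp_distance p f g =
     ennreal_powr (\<integral>\<^sup>+ t\<in>{0..}. ennreal (\<bar>f t - g t\<bar> powr p) \<partial>lebesgue) (1 / p)"

definition interleavings :: "(real \<Rightarrow> real) \<Rightarrow> (real \<Rightarrow> real) \<Rightarrow> real set" where
  "interleavings f g = {\<epsilon>. 0 \<le> \<epsilon> \<and> (\<forall>t\<ge>0. f t \<ge> g (t + \<epsilon>) \<and> g t \<ge> f (t + \<epsilon>))}"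

definition interleaving_distance :: "(real \<Rightarrow> real) \<Rightarrow> (real \<Rightarrow> real) \<Rightarrow> ennreal" where
  "interleaving_distance f g =
     (if interleavings f g \<noteq> {} then ennreal (Inf (interleavings f g)) else \<infinity>)"

end

theory Submission
  imports Defs
begin

text \<open>
  If \<open>d X Y = \<epsilon> < \<infinity>\<close>, the triangle inequality makes the stabilizations \<open>f\<close> and \<open>g\<close> of \<open>X\<close> and
  \<open>Y\<close> \<open>\<epsilon>\<close>-interleaved. They are non-increasing and take values in \<open>{0..c}\<close>, so \<open>\<bar>f - g\<bar>\<close> is the
  sum of the indicators of the layers \<open>{t. min (f t) (g t) \<le> n < max (f t) (g t)}\<close> for \<open>n < c\<close>.
  By the interleaving each layer has diameter at most \<open>\<epsilon>\<close>, which bounds the integral of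
  \<open>\<bar>f - g\<bar> powr p \<le> c powr (p - 1) * \<bar>f - g\<bar>\<close> by \<open>c powr p * \<epsilon>\<close>.
\<close>

lemma ennreal_powr_mono_ennreal:
  assumes "x \<le> ennreal r" and "0 \<le> r" and "0 \<le> a"
  shows "ennreal_powr x a \<le> ennreal (r powr a)"
proof -
  have "x \<noteq> \<infinity>"
    using assms(1) by (auto simp: top_unique)
  moreover have "enn2real x \<le> r"
    using assms enn2real_leI by blast
  ultimately show ?thesis
    using assms(3) by (auto simp: ennreal_powr_def intro!: ennreal_leI powr_mono2)
qed

text \<open>The left endpoint is \<open>Inf A\<close>: for each \<open>t\<close> in
  \<open>A\<close>, the number \<open>t - e\<close> is a lower bound of \<open>A\<close>. The
  interval serves as a measurable majorant of a layer, of known length.\<close>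

lemma bounded_below_diameter_subset_atLeastAtMost:
  fixes A :: "real set"
  assumes "bdd_below A" and "\<And>s t. s \<in> A \<Longrightarrow> t \<in> A \<Longrightarrow> t \<le> s + e"
  shows "\<exists>a. A \<subseteq> {a..a + e}"
proof (cases "A = {}")
  case False
  have "t \<le> Inf A + e" if "t \<in> A" for t
    using cInf_greatest[OF False, of "t - e"] assms(2)[OF _ that] by fastforce
  then show ?thesis
    using cInf_lower[OF _ assms(1)] by (intro exI[of _ "Inf A"]) auto
qed auto

text \<open>The indicator is 1 exactly on \<open>{min m n..<max m n}\<close>, which lies below
  \<open>c\<close>.\<close>

lemma abs_diff_nat_eq_sum_layers:
  fixes m n c :: nat
  assumes "m \<le> c" and "n \<le> c"
  shows "\<bar>real m - real n\<bar> = (\<Sum>k<c. of_bool (min m n \<le> k \<and> k < max m n))"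
proof -
  have "(\<Sum>k<c. of_bool (min m n \<le> k \<and> k < max m n) :: real)
      = real (card ({..<c} \<inter> {k. min m n \<le> k \<and> k < max m n}))"
    by (simp add: sum_of_bool_eq)
  also have "{..<c} \<inter> {k. min m n \<le> k \<and> k < max m n} = {min m n..<max m n}"
    using assms by auto
  finally show ?thesis
    by (auto simp: min_def max_def)
qed

lemma Lp_distance_le_of_interleaving:
  fixes F G :: "real \<Rightarrow> nat"
  assumes F: "antimono_on {0..} F" and G: "antimono_on {0..} G"
    and e: "0 \<le> e"
    and FG: "\<And>t. 0 \<le> t \<Longrightarrow> G (t + e) \<le> F t" and GF: "\<And>t. 0 \<le> t \<Longrightarrow> F (t + e) \<le> G t"
    and c: "F 0 \<le> c" "G 0 \<le> c" and p: "1 \<le> p"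
  shows "Lp_distance p (\<lambda>t. real (F t)) (\<lambda>t. real (G t)) \<le> ennreal (real c * e powr (1 / p))"
proof -
  have Fd: "F t \<le> F s" and Gd: "G t \<le> G s" if "0 \<le> s" "s \<le> t" for s t
    using monotone_onD[OF F, of s t] monotone_onD[OF G, of s t] that by auto
  define A where "A n = {t. 0 \<le> t \<and> min (F t) (G t) \<le> n \<and> n < max (F t) (G t)}" for n
  have "\<exists>a. A n \<subseteq> {a..a + e}" for n
  proof (rule bounded_below_diameter_subset_atLeastAtMost)
    show "bdd_below (A n)"
      by (auto simp: A_def intro: bdd_belowI[of _ 0])
    show "t \<le> s + e" if "s \<in> A n" "t \<in> A n" for s t
    proof (rule ccontr)
      \<comment> \<open>Monotonicity and interleaving give
        \<open>F t \<le> F (s + e) \<le> G s\<close> and \<open>F t \<le> F s\<close>, and likewise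
        for \<open>G t\<close>. Hence \<open>max (F t) (G t) \<le> min (F s) (G s) \<le> n\<close>,
        so \<open>t\<close> is not in layer \<open>n\<close>.\<close>
      assume "\<not> t \<le> s + e"
      then have "F t \<le> F (s + e)" "G t \<le> G (s + e)" "F t \<le> F s" "G t \<le> G s"
        using that e by (auto simp: A_def intro!: Fd Gd)
      moreover have "G (s + e) \<le> F s" "F (s + e) \<le> G s"
        using that FG GF by (auto simp: A_def)
      ultimately show False
        using that by (auto simp: A_def)
    qed
  qed
  then obtain a where a: "\<And>n. A n \<subseteq> {a n..a n + e}"
    by metis
  have pointwise: "ennreal (\<bar>real (F t) - real (G t)\<bar> powr p) * indicator {0..} t
      \<le> ennreal (real c powr (p - 1)) * (\<Sum>n<c. indicator {a n..a n + e} t)" for t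
  proof (cases "0 \<le> t")
    case True
    let ?D = "\<bar>real (F t) - real (G t)\<bar>"
    have bounds: "F t \<le> c" "G t \<le> c"
      using Fd[of 0 t] Gd[of 0 t] c True by auto
    have "?D = (\<Sum>n<c. of_bool (min (F t) (G t) \<le> n \<and> n < max (F t) (G t)))"
      by (rule abs_diff_nat_eq_sum_layers[OF bounds])
    also have "\<dots> \<le> (\<Sum>n<c. indicator {a n..a n + e} t)"
      using a True by (intro sum_mono) (fastforce simp: A_def indicator_def)
    finally have layers: "?D \<le> (\<Sum>n<c. indicator {a n..a n + e} t)" .
    \<comment> \<open>One factor \<open>?D\<close> is split off to be decomposed into layers; the
      remaining power is bounded by means of \<open>?D \<le> c\<close>.\<close>
    have "?D powr p = ?D powr (p - 1) * ?D"
      by (cases "?D = 0") (auto simp: powr_diff)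
    also have "\<dots> \<le> real c powr (p - 1) * (\<Sum>n<c. indicator {a n..a n + e} t)"
      using bounds p layers by (intro mult_mono powr_mono2) auto
    finally have "ennreal (?D powr p)
        \<le> ennreal (real c powr (p - 1) * (\<Sum>n<c. indicator {a n..a n + e} t))"
      by (rule ennreal_leI)
    then show ?thesis
      using True by (simp add: ennreal_mult sum_nonneg flip: sum_ennreal ennreal_indicator)
  qed auto
  have "(\<integral>\<^sup>+ t\<in>{0..}. ennreal (\<bar>real (F t) - real (G t)\<bar> powr p) \<partial>lebesgue)
      \<le> (\<integral>\<^sup>+ t. ennreal (real c powr (p - 1)) * (\<Sum>n<c. indicator {a n..a n + e} t) \<partial>lebesgue)"
    by (intro nn_integral_mono pointwise)
  \<comment> \<open>Each of the \<open>c\<close> intervals has Lebesgue measure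
    \<open>e\<close>.\<close>
  also have "\<dots> = ennreal (real c powr (p - 1)) * (\<Sum>n<c. ennreal e)"
    using e by (subst nn_integral_cmult nn_integral_sum;
        (intro borel_measurable_sum borel_measurable_indicator)?; simp)+
  also have "\<dots> = ennreal (real c powr (p - 1) * (real c * e))"
    using e by (simp add: ennreal_mult ennreal_of_nat_eq_real_of_nat)
  also have "real c powr (p - 1) * (real c * e) = real c powr p * e"
    by (cases "c = 0") (auto simp: powr_diff)
  finally have "Lp_distance p (\<lambda>t. real (F t)) (\<lambda>t. real (G t))
      \<le> ennreal ((real c powr p * e) powr (1 / p))"
    unfolding Lp_distance_def using e p by (intro ennreal_powr_mono_ennreal) auto
  also have "(real c powr p * e) powr (1 / p) = real c * e powr (1 / p)"
    using e p by (simp add: powr_mult powr_powr)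
  finally show ?thesis .
qed

text \<open>This serves the case of infinite \<open>d X Y\<close> and \<open>c = 0\<close>, where
  the upper bound is \<open>0 * \<infinity> = 0\<close>.\<close>

lemma Lp_distance_eq_0:
  assumes "\<And>t. 0 \<le> t \<Longrightarrow> f t = g t"
  shows "Lp_distance p f g = 0"
proof -
  have "(\<integral>\<^sup>+ t\<in>{0..}. ennreal (\<bar>f t - g t\<bar> powr p) \<partial>lebesgue) = (\<integral>\<^sup>+ t. 0 \<partial>(lebesgue :: real measure))"
    using assms by (intro nn_integral_cong) (auto simp: indicator_def)
  then show ?thesis
    by (simp add: Lp_distance_def ennreal_powr_def)
qed

text \<open>Keeping the values in \<open>nat\<close> makes the decomposition into layers
  available.\<close>

definition nat_stabilization ::
    "'a set \<Rightarrow> ('a \<Rightarrow> 'a \<Rightarrow> ennreal) \<Rightarrow> ('a \<Rightarrow> nat) \<Rightarrow> 'a \<Rightarrow> real \<Rightarrow> nat" where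
  "nat_stabilization T d R X t = (LEAST n. n \<in> {R Y | Y. Y \<in> T \<and> d X Y \<le> ennreal t})"

lemma stabilization_eq: "stabilization T d R X = (\<lambda>t. real (nat_stabilization T d R X t))"
  by (simp add: fun_eq_iff stabilization_def nat_stabilization_def)

lemma nat_stabilization_le:
  assumes "Y \<in> T" and "d X Y \<le> ennreal t"
  shows "nat_stabilization T d R X t \<le> R Y"
  unfolding nat_stabilization_def using assms by (intro Least_le) auto

text \<open>The set of values contains \<open>R X\<close>, since \<open>d X X = 0\<close>, so
  \<open>LEAST\<close> picks one of its members.\<close>

lemma nat_stabilization_attained:
  assumes "pseudometric_on T d" and "X \<in> T"
  obtains Y where "Y \<in> T" "d X Y \<le> ennreal t" "nat_stabilization T d R X t = R Y"
proof -
  have "R X \<in> {R Y | Y. Y \<in> T \<and> d X Y \<le> ennreal t}"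
    using assms by (auto simp: pseudometric_on_def)
  from LeastI[of "\<lambda>n. n \<in> {R Y | Y. Y \<in> T \<and> d X Y \<le> ennreal t}", OF this] show ?thesis
    using that unfolding nat_stabilization_def by blast
qed

text \<open>A minimiser \<open>Z\<close> for \<open>Y\<close> at radius \<open>t\<close> is within
  \<open>t + e\<close> of \<open>X\<close> by the triangle inequality, so it competes in the minimum
  for \<open>X\<close>.\<close>

lemma nat_stabilization_shift_le:
  assumes d: "pseudometric_on T d" and X: "X \<in> T" and Y: "Y \<in> T"
    and "d X Y \<le> ennreal e" and "0 \<le> e" and "0 \<le> t"
  shows "nat_stabilization T d R X (t + e) \<le> nat_stabilization T d R Y t"
proof -
  obtain Z where Z: "Z \<in> T" "d Y Z \<le> ennreal t" "nat_stabilization T d R Y t = R Z"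
    using nat_stabilization_attained[OF d Y] .
  have "d X Z \<le> d X Y + d Y Z"
    using d X Y Z(1) by (auto simp: pseudometric_on_def)
  also have "\<dots> \<le> ennreal e + ennreal t"
    using assms(4) Z(2) by (rule add_mono)
  also have "\<dots> = ennreal (t + e)"
    using assms(5,6) by (simp add: add.commute)
  finally show ?thesis
    using nat_stabilization_le[OF Z(1)] Z(3) by simp
qed

text \<open>This is the shift inequality for \<open>X\<close> against itself, with shift
  \<open>t - s\<close>.\<close>

lemma antimono_nat_stabilization:
  assumes d: "pseudometric_on T d" and X: "X \<in> T"
  shows "antimono_on {0..} (nat_stabilization T d R X)"
proof (rule monotone_onI)
  fix s t :: real
  assume "s \<in> {0..}" "t \<in> {0..}" "s \<le> t"
  moreover have "d X X = 0"
    using d X by (simp add: pseudometric_on_def)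
  ultimately show "nat_stabilization T d R X t \<le> nat_stabilization T d R X s"
    using nat_stabilization_shift_le[OF d X X, of "t - s" s R] by simp
qed

theorem proposition2p1:
  fixes T :: "'a set" and d :: "'a \<Rightarrow> 'a \<Rightarrow> ennreal" and R :: "'a \<Rightarrow> nat" and p :: real
  assumes "pseudometric_on T d" and "p \<ge> 1"
  shows "\<forall>X\<in>T. \<forall>Y\<in>T.
    d X Y \<ge> interleaving_distance (stabilization T d R X) (stabilization T d R Y) \<and>
    ennreal (max (stabilization T d R X 0) (stabilization T d R Y 0)) * ennreal_powr (d X Y) (1 / p)
      \<ge> Lp_distance p (stabilization T d R X) (stabilization T d R Y)"
proof (intro ballI)
  fix X Y
  assume X: "X \<in> T" and Y: "Y \<in> T"
  let ?F = "nat_stabilization T d R X" and ?G = "nat_stabilization T d R Y"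
  let ?f = "stabilization T d R X" and ?g = "stabilization T d R Y"
  define c where "c = max (?F 0) (?G 0)"
  have c: "max (?f 0) (?g 0) = real c"
    by (simp add: stabilization_eq c_def of_nat_max)
  note F = antimono_nat_stabilization[OF assms(1) X, of R]
  note G = antimono_nat_stabilization[OF assms(1) Y, of R]
  show "d X Y \<ge> interleaving_distance ?f ?g \<and>
    ennreal (max (?f 0) (?g 0)) * ennreal_powr (d X Y) (1 / p) \<ge> Lp_distance p ?f ?g"
  proof (cases "d X Y")
    case (real e)
    have dXY: "d X Y \<le> ennreal e" and dYX: "d Y X \<le> ennreal e"
      using real assms(1) X Y by (auto simp: pseudometric_on_def)
    note FG = nat_stabilization_shift_le[OF assms(1) Y X dYX real(1), of _ R]
    note GF = nat_stabilization_shift_le[OF assms(1) X Y dXY real(1), of _ R]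
    \<comment> \<open>The distance itself is an admissible shift, so the infimum is at most
      \<open>e\<close>.\<close>
    have mem: "e \<in> interleavings ?f ?g"
      using real(1) FG GF by (auto simp: interleavings_def stabilization_eq)
    then have "Inf (interleavings ?f ?g) \<le> e"
      by (intro cInf_lower bdd_belowI[of _ 0]) (auto simp: interleavings_def)
    then have "interleaving_distance ?f ?g \<le> d X Y"
      using mem real(2) by (auto simp: interleaving_distance_def intro: ennreal_leI)
    moreover have "Lp_distance p ?f ?g \<le> ennreal (real c * e powr (1 / p))"
      unfolding stabilization_eq
      by (rule Lp_distance_le_of_interleaving[OF F G real(1) FG GF _ _ assms(2)])
        (auto simp: c_def)
    ultimately show ?thesis
      unfolding c using real by (simp add: ennreal_powr_def ennreal_mult)
  next
    case top
    \<comment> \<open>The bound is infinite unless \<open>c = 0\<close>. In that case both functions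
      vanish on \<open>{0..}\<close>, being non-increasing with value 0 at 0.\<close>
    have "Lp_distance p ?f ?g = 0" if "c = 0"
    proof (rule Lp_distance_eq_0)
      fix t :: real
      assume "0 \<le> t"
      then have "?F t \<le> ?F 0" "?G t \<le> ?G 0"
        using monotone_onD[OF F, of 0 t] monotone_onD[OF G, of 0 t] by auto
      then show "?f t = ?g t"
        using that by (auto simp: stabilization_eq c_def max_def split: if_splits)
    qed
    then show ?thesis
      unfolding c using top
      by (cases "c = 0") (auto simp: ennreal_powr_def ennreal_mult_top)
  qed
qed

end
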